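(* There exists an absolute constant $c>0$ such that the following holds. Let $N,M,T$ be positive integers and $d>0$ a real number with $N\ge MT/d$. Let $\delta\in(0,1)$ and $\alpha>1$ be real numbers with $\alpha\cdot 2^d<\delta^3 e^{T/32}/128$. Let $\mathcal{H}$ be a family of hash functions $[N]\to[M]$ of size at most $2^d$ and $H$ a uniformly random member of $\mathcal{H}$. Then there exist an integer $K\ge c\,\delta^2MT/(d\cdot\log(\alpha/\delta))$ and a block $K$-source $\mathbf{X}=(X_1,\dots,X_T)$ over $[N]^T$ (independent of $H$) such that $\mathbf{Y}=(H(X_1),\dots,H(X_T))$ is $(1-\delta)$-far in statistical distance from every distribution $\mathbf{Z}=(Z_1,\dots,Z_T)$ on $[M]^T$ with $\mathrm{cp}(\mathbf{Z})\le\alpha/M^T$. In particular, $\mathbf{Y}$ is $(1-\delta)$-far from the uniform distribution on $[M]^T$.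
   Context: $[n]=\{1,\dots,n\}$. A hash family is a multiset of functions $[N]\to[M]$. $\mathrm{cp}(X)=\sum_x\Pr[X=x]^2$. A sequence $(X_1,\dots,X_T)$ over $[N]^T$ is a block $K$-source if for every $i$ and every $x_{<i}$ in the support of $(X_1,\dots,X_{i-1})$, $\mathrm{cp}(X_i\mid X_{<i}=x_{<i})\le 1/K$. Statistical distance: $\Delta(X,Y)=\max_S|\Pr[X\in S]-\Pr[Y\in S]|$; $\varepsilon$-far means $\Delta\ge\varepsilon$.
   Formalization: The formal theorem assumes M ≥ 2 (for M = 1, Y is itself uniform, so the claim fails) and replaces log(α/δ) by max(1, log₂(α/δ)), since as α/δ → 1 the stated bound on K would exceed N, which is impossible for a block K-source over [N]^T. *)

theory Defs
  imports "HOL-Probability.Probability"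
begin

definition seqs :: "nat \<Rightarrow> nat \<Rightarrow> nat list set" where
  "seqs n T = {xs. length xs = T \<and> set xs \<subseteq> {1..n}}"

definition hash_family :: "nat \<Rightarrow> nat \<Rightarrow> (nat \<Rightarrow> nat) multiset \<Rightarrow> bool" where
  "hash_family N M \<H> \<longleftrightarrow> set_mset \<H> \<subseteq> {1..N} \<rightarrow>\<^sub>E {1..M}"

definition cp :: "'a pmf \<Rightarrow> real" where
  "cp p = (\<Sum>\<^sub>\<infinity>x. (pmf p x)\<^sup>2)"

(* The supremum is attained (by the event that p gives larger mass than q), so it is the
   maximum of the usual definition. *)
definition stat_dist :: "'a pmf \<Rightarrow> 'a pmf \<Rightarrow> real" where
  "stat_dist p q = (SUP S. \<bar>measure (measure_pmf p) S - measure (measure_pmf q) S\<bar>)"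

definition far :: "real \<Rightarrow> 'a pmf \<Rightarrow> 'a pmf \<Rightarrow> bool" where
  "far \<epsilon> p q \<longleftrightarrow> stat_dist p q \<ge> \<epsilon>"

(* Lists are 0-indexed: for i < T the i-th entry is the block X_{i+1}, and the prefix
   "take i" is (X_1, ..., X_i). *)
definition block_source :: "nat \<Rightarrow> nat \<Rightarrow> real \<Rightarrow> nat list pmf \<Rightarrow> bool" where
  "block_source N T K X \<longleftrightarrow>
     set_pmf X \<subseteq> seqs N T \<and>
     (\<forall>i<T. \<forall>p\<in>set_pmf (map_pmf (take i) X).
        cp (map_pmf (\<lambda>xs. xs ! i) (cond_pmf X {xs. take i xs = p})) \<le> 1 / K)"

(* The distribution of (H(X_1), ..., H(X_T)) for H uniform on the multiset and independent of X:
   the pair (H, X) has the product distribution. *)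
definition hashed :: "(nat \<Rightarrow> nat) multiset \<Rightarrow> nat list pmf \<Rightarrow> nat list pmf" where
  "hashed \<H> X = map_pmf (\<lambda>(h, xs). map h xs) (pair_pmf (pmf_of_multiset \<H>) X)"

(* Two degenerate ranges have to be avoided in a lower bound on K of the form
   c * \<delta>^2 * M * T / (d * log (\<alpha> / \<delta>)) for sources that defeat every family of 2^d functions.
   For M = 1 the hashed sequence is constant, hence uniform, so M \<ge> 2 is needed.  As \<alpha> / \<delta> tends
   to 1 the bound tends to infinity and exceeds N, while a block K-source over {1..N} has K \<le> N;
   so the logarithm is replaced by max 1 (log 2 (\<alpha> / \<delta>)), which is the logarithm itself as soon
   as \<alpha> \<ge> 2 * \<delta>. *)

end

theory Submission
  imports Defs
begin

text \<open>Take the blocks of \<open>X\<close> independent and uniform on sets \<open>A\<^sub>i\<close>, and let \<open>P\<^sub>h\<close> be the law of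
  \<open>(h X\<^sub>1, \<dots>, h X\<^sub>T)\<close>. The test is the union over \<open>h\<close> of the sets of sequences on which the
  likelihood ratio \<open>M\<^sup>T P\<^sub>h\<close> exceeds a threshold \<open>L\<close>. Each of these sets has at most \<open>M\<^sup>T / L\<close>
  elements, so by Cauchy--Schwarz a distribution of small collision probability gives the union
  little mass. Outside of its own set, \<open>P\<^sub>h\<close> has mass at most \<open>sqrt L\<close> times the product over \<open>i\<close>
  of the Bhattacharyya coefficients between the law of \<open>h X\<^sub>i\<close> and the uniform distribution. If
  \<open>A\<^sub>i\<close> is a random \<open>K\<close>-subset of \<open>{1..2 * K}\<close>, the fluctuation of the bucket sizes
  makes the expected coefficient at most \<open>1 - M / (100 * K)\<close>, whatever \<open>h\<close> is; since the \<open>A\<^sub>i\<close> are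
  chosen independently, the expected product is the power of this bound, and no union bound over
  \<open>h\<close> is needed. The degenerate ranges use a constant sequence of sets: \<open>{1..K}\<close> if
  \<open>2 * K \<le> M\<close>, and the preimage of about half of the buckets if \<open>d < 1\<close>, where the family has
  only one member.\<close>

section \<open>Collision probability and statistical distance\<close>

lemma cp_finite:
  assumes "finite A" "set_pmf p \<subseteq> A"
  shows "cp p = (\<Sum>x\<in>A. (pmf p x)\<^sup>2)"
proof -
  have "cp p = (\<Sum>\<^sub>\<infinity>x\<in>A. (pmf p x)\<^sup>2)"
    unfolding cp_def using assms(2)
    by (intro infsum_cong_neutral) (auto simp: set_pmf_iff)
  then show ?thesis using assms(1) by simp
qed

lemma cp_le_of_pmf_le:
  assumes "finite (set_pmf p)" "\<And>x. pmf p x \<le> r"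
  shows "cp p \<le> r"
proof -
  have "cp p \<le> (\<Sum>x\<in>set_pmf p. r * pmf p x)"
    unfolding cp_finite[OF assms(1) order_refl] power2_eq_square
    by (intro sum_mono mult_right_mono assms) auto
  also have "\<dots> = r"
    by (simp add: sum_distrib_left[symmetric] sum_pmf_eq_1 assms)
  finally show ?thesis .
qed

lemma measure_le_sqrt_cp:
  assumes "finite (set_pmf p)" "finite S"
  shows "measure (measure_pmf p) S \<le> sqrt (real (card S) * cp p)"
proof -
  have "measure (measure_pmf p) S = (\<Sum>x\<in>S. 1 * pmf p x)"
    using assms by (simp add: measure_measure_pmf_finite)
  also have "\<dots> \<le> sqrt ((\<Sum>x\<in>S. 1\<^sup>2) * (\<Sum>x\<in>S. (pmf p x)\<^sup>2))"
    by (intro real_le_rsqrt Cauchy_Schwarz_ineq_sum)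
  also have "(\<Sum>x\<in>S. (pmf p x)\<^sup>2) \<le> cp p"
    unfolding cp_finite[OF finite_UnI[OF assms] Un_upper1]
    by (intro sum_mono2) (use assms in auto)
  then have "sqrt ((\<Sum>x\<in>S. 1\<^sup>2) * (\<Sum>x\<in>S. (pmf p x)\<^sup>2)) \<le> sqrt (real (card S) * cp p)"
    by (auto intro!: mult_left_mono)
  finally show ?thesis .
qed

lemma farI:
  assumes "measure (measure_pmf p) (- S) \<le> \<delta> / 2" "measure (measure_pmf q) S \<le> \<delta> / 2"
  shows "far (1 - \<delta>) p q"
proof -
  have "measure (measure_pmf p) S = 1 - measure (measure_pmf p) (- S)"
    using measure_pmf.prob_compl[of S p] by (simp add: Compl_eq_Diff_UNIV)
  then have "1 - \<delta> \<le> \<bar>measure (measure_pmf p) S - measure (measure_pmf q) S\<bar>"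
    using assms by linarith
  also have "\<dots> \<le> stat_dist p q"
    unfolding stat_dist_def
  proof (rule cSUP_upper)
    show "bdd_above (range (\<lambda>S. \<bar>measure (measure_pmf p) S - measure (measure_pmf q) S\<bar>))"
    proof (rule bdd_aboveI[of _ 1], clarify)
      fix S
      show "\<bar>measure (measure_pmf p) S - measure (measure_pmf q) S\<bar> \<le> 1"
        using measure_pmf.prob_le_1[of p S] measure_pmf.prob_le_1[of q S]
          measure_nonneg[of "measure_pmf p" S] measure_nonneg[of "measure_pmf q" S]
        by linarith
    qed
  qed auto
  finally show ?thesis by (simp add: far_def)
qed

section \<open>Output sequences and the likelihood ratio test\<close>

lemma seqs_Suc: "seqs M (Suc T) = (\<lambda>(b, bs). b # bs) ` ({1..M} \<times> seqs M T)"
  by (fastforce simp: seqs_def length_Suc_conv)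

lemma finite_seqs: "finite (seqs M T)"
  using finite_lists_length_eq[of "{1..M}" T] by (simp add: seqs_def conj_commute)

lemma card_seqs: "card (seqs M T) = M ^ T"
  using card_lists_length_eq[of "{1..M}" T] by (simp add: seqs_def conj_commute)

text \<open>Conditioning on the hash function makes the output a mixture of the laws
  \<open>map_pmf (map h) X\<close>; the weights \<open>pmf (pmf_of_multiset \<H>) h\<close> account
  for repeated members of the multiset.\<close>

lemma measure_hashed:
  assumes "\<H> \<noteq> {#}"
  shows "measure (measure_pmf (hashed \<H> X)) S =
    (\<Sum>h\<in>set_mset \<H>. pmf (pmf_of_multiset \<H>) h * measure (measure_pmf (map_pmf (map h) X)) S)"
proof -
  have "hashed \<H> X = pmf_of_multiset \<H> \<bind> (\<lambda>h. map_pmf (map h) X)"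
    by (simp add: hashed_def pair_pmf_def map_bind_pmf map_pmf_def bind_assoc_pmf bind_return_pmf)
  then have "measure (measure_pmf (hashed \<H> X)) S =
      measure_pmf.expectation (pmf_of_multiset \<H>) (\<lambda>h. measure (measure_pmf (map_pmf (map h) X)) S)"
    by (simp add: measure_pmf_bind subprob_space.measure_bind[where N = "count_space UNIV"]
        measure_pmf.subprob_space_axioms measure_pmf_in_subprob_algebra)
  also have "\<dots> = (\<Sum>h\<in>set_mset \<H>. pmf (pmf_of_multiset \<H>) h * measure (measure_pmf (map_pmf (map h) X)) S)"
    by (subst integral_measure_pmf[of "set_mset \<H>"]) (auto simp: assms)
  finally show ?thesis .
qed

text \<open>Where the likelihood ratio is at most \<open>L\<close>, one of the two factors in
  \<open>sqrt (pmf P y) * sqrt (pmf P y)\<close> can be traded for \<open>sqrt (L * u)\<close>. With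
  \<open>u\<close> the uniform mass, the sum that remains is a Bhattacharyya coefficient.\<close>

lemma sum_pmf_below_threshold:
  assumes "finite A" "set_pmf P \<subseteq> A" "u \<ge> 0" "L \<ge> 0"
    "\<And>y. y \<in> A - S \<Longrightarrow> pmf P y \<le> L * u"
  shows "measure (measure_pmf P) (- S) \<le> sqrt L * (\<Sum>y\<in>A. sqrt (pmf P y * u))"
proof -
  have "measure (measure_pmf P) (- S) = measure (measure_pmf P) (A - S)"
    by (rule measure_pmf.finite_measure_eq_AE) (use assms in \<open>auto simp: AE_measure_pmf_iff\<close>)
  also have "\<dots> = (\<Sum>y\<in>A - S. pmf P y)"
    by (rule measure_measure_pmf_finite) (use assms in auto)
  also have "\<dots> \<le> (\<Sum>y\<in>A - S. sqrt L * sqrt (pmf P y * u))"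
  proof (rule sum_mono)
    fix y assume y: "y \<in> A - S"
    have "pmf P y = sqrt (pmf P y) * sqrt (pmf P y)" by simp
    also have "\<dots> \<le> sqrt (pmf P y) * sqrt (L * u)"
      by (intro mult_left_mono) (use assms(5)[OF y] in auto)
    finally show "pmf P y \<le> sqrt L * sqrt (pmf P y * u)"
      by (simp add: real_sqrt_mult mult_ac)
  qed
  also have "\<dots> \<le> sqrt L * (\<Sum>y\<in>A. sqrt (pmf P y * u))"
    unfolding sum_distrib_left using assms by (intro sum_mono2) auto
  finally show ?thesis .
qed

text \<open>Balances the two errors of the test \<open>U\<close>: the hashed sequence misses
  \<open>U\<close> with probability at most \<open>sqrt L * B\<close>, and \<open>Z\<close> hits it
  with probability at most \<open>sqrt (D * \<alpha> / L)\<close>. The choice of \<open>L\<close>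
  makes the second bound equal to \<open>\<delta> / 2\<close>, and \<open>num\<close> says exactly
  that the first is at most \<open>\<delta> / 2\<close>.\<close>

lemma hashed_far:
  fixes D \<alpha> \<delta> B :: real
  assumes H: "\<H> \<noteq> {#}" "real (size \<H>) \<le> D"
    and M: "M > 0" and \<delta>: "\<delta> > 0" and \<alpha>: "\<alpha> > 0"
    and img: "\<And>h. h \<in># \<H> \<Longrightarrow> set_pmf (map_pmf (map h) X) \<subseteq> seqs M T"
    and B: "(\<Sum>h\<in>set_mset \<H>. pmf (pmf_of_multiset \<H>) h *
             (\<Sum>y\<in>seqs M T. sqrt (pmf (map_pmf (map h) X) y * (1 / real M ^ T)))) \<le> B"
    and num: "16 * D * \<alpha> * B\<^sup>2 \<le> \<delta> ^ 4"
    and Z: "set_pmf Z \<subseteq> seqs M T" "cp Z \<le> \<alpha> / real M ^ T"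
  shows "far (1 - \<delta>) (hashed \<H> X) Z"
proof -
  define P where "P = (\<lambda>h::nat \<Rightarrow> nat. map_pmf (map h) X)"
  have P: "map_pmf (map h) X = P h" for h by (simp add: P_def)
  define u where "u = 1 / real M ^ T"
  define L where "L = 4 * D * \<alpha> / \<delta>\<^sup>2"
  define S where "S = (\<lambda>h::nat \<Rightarrow> nat. {y \<in> seqs M T. L * u < pmf (P h) y})"
  define U where "U = (\<Union>h\<in>set_mset \<H>. S h)"
  have u: "u > 0" using M by (simp add: u_def)
  have size1: "1 \<le> size \<H>" using H(1) by (simp add: Suc_leI nonempty_has_size)
  then have D: "D > 0" using H(2) by linarith
  then have L: "L > 0" using \<alpha> \<delta> by (simp add: L_def)
  have B0: "0 \<le> B"
    by (rule order_trans[OF _ B]) (auto intro!: sum_nonneg mult_nonneg_nonneg)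
  have "measure (measure_pmf (hashed \<H> X)) (- U) \<le>
      (\<Sum>h\<in>set_mset \<H>. pmf (pmf_of_multiset \<H>) h * (sqrt L * (\<Sum>y\<in>seqs M T. sqrt (pmf (P h) y * u))))"
    unfolding measure_hashed[OF H(1)] P
  proof (intro sum_mono mult_left_mono pmf_nonneg)
    fix h assume h: "h \<in> set_mset \<H>"
    show "measure (measure_pmf (P h)) (- U) \<le> sqrt L * (\<Sum>y\<in>seqs M T. sqrt (pmf (P h) y * u))"
      by (rule sum_pmf_below_threshold)
        (use h u L img[OF h] in \<open>auto simp: finite_seqs P_def U_def S_def\<close>)
  qed
  also have "\<dots> = sqrt L * (\<Sum>h\<in>set_mset \<H>. pmf (pmf_of_multiset \<H>) h * (\<Sum>y\<in>seqs M T. sqrt (pmf (P h) y * u)))"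
    by (simp add: sum_distrib_left mult_ac)
  also have "\<dots> \<le> sqrt L * B"
    using B L by (intro mult_left_mono) (auto simp: P_def u_def)
  also have "\<dots> \<le> \<delta> / 2"
  proof (rule power2_le_imp_le)
    have "4 * (L * B\<^sup>2) \<le> \<delta>\<^sup>2"
      using num \<delta> by (simp add: L_def field_simps power4_eq_xxxx power2_eq_square)
    then show "(sqrt L * B)\<^sup>2 \<le> (\<delta> / 2)\<^sup>2"
      using L by (simp add: power_mult_distrib power_divide)
  qed (use \<delta> in auto)
  finally have Y: "measure (measure_pmf (hashed \<H> X)) (- U) \<le> \<delta> / 2" .
  \<comment> \<open>Each element of \<open>S h\<close> has mass above \<open>L * u\<close> under
    \<open>P h\<close>, and the total mass is at most 1.\<close>
  have card_S: "real (card (S h)) * (L * u) \<le> 1" if "h \<in># \<H>" for h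
  proof -
    have "real (card (S h)) * (L * u) = (\<Sum>y\<in>S h. L * u)" by simp
    also have "\<dots> \<le> (\<Sum>y\<in>S h. pmf (P h) y)" by (intro sum_mono) (auto simp: S_def)
    also have "\<dots> = measure (measure_pmf (P h)) (S h)"
      by (rule measure_measure_pmf_finite[symmetric]) (auto simp: S_def finite_seqs)
    finally show ?thesis using measure_pmf.prob_le_1[of "P h" "S h"] by linarith
  qed
  have "real (card U) \<le> (\<Sum>h\<in>set_mset \<H>. real (card (S h)))"
    unfolding U_def of_nat_sum[symmetric] of_nat_le_iff by (rule card_UN_le) simp
  also have "\<dots> \<le> (\<Sum>h\<in>set_mset \<H>. 1 / (L * u))"
    using card_S L u by (intro sum_mono) (simp add: pos_le_divide_eq)
  also have "\<dots> = real (card (set_mset \<H>)) / (L * u)" by simp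
  also have "card (set_mset \<H>) \<le> size \<H>"
    unfolding size_multiset_overloaded_eq card_eq_sum by (intro sum_mono) simp
  then have "real (card (set_mset \<H>)) / (L * u) \<le> D / (L * u)"
    using H(2) L u by (intro divide_right_mono) auto
  finally have "real (card U) * cp Z \<le> (D / (L * u)) * (\<alpha> * u)"
    using Z(2) L u D \<alpha> cp_finite[OF finite_seqs Z(1)]
    by (intro mult_mono) (auto simp: u_def sum_nonneg)
  also have "\<dots> = (\<delta> / 2)\<^sup>2"
    using L u D \<alpha> \<delta> by (simp add: L_def field_simps power2_eq_square)
  finally have "sqrt (real (card U) * cp Z) \<le> \<delta> / 2"
    using \<delta> by (intro real_le_lsqrt) auto
  moreover have "measure (measure_pmf Z) U \<le> sqrt (real (card U) * cp Z)"
    by (rule measure_le_sqrt_cp) (use Z finite_seqs in \<open>auto simp: U_def S_def intro: finite_subset\<close>)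
  ultimately show ?thesis using Y by (intro farI[of _ U]) auto
qed

lemma cp_uniform_seqs:
  assumes "M > 0"
  shows "cp (pmf_of_set (seqs M T)) = 1 / real M ^ T"
proof -
  have "card (seqs M T) \<noteq> 0" using assms by (simp add: card_seqs)
  then have ne: "seqs M T \<noteq> {}" by auto
  show ?thesis
    by (subst cp_finite[OF finite_seqs[of M T]])
      (use ne assms in \<open>auto simp: finite_seqs card_seqs power2_eq_square field_simps\<close>)
qed

section \<open>Product sources\<close>

lemma listset_iff: "xs \<in> listset As \<longleftrightarrow> list_all2 (\<in>) xs As"
  by (induction As arbitrary: xs) (auto simp: set_Cons_def list_all2_Cons2)

lemma listset_iff_nth:
  "xs \<in> listset As \<longleftrightarrow> length xs = length As \<and> (\<forall>i<length As. xs ! i \<in> As ! i)"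
  by (auto simp: listset_iff list_all2_conv_all_nth)

lemma set_Cons_image: "set_Cons A B = (\<lambda>(x, xs). x # xs) ` (A \<times> B)"
  by (auto simp: set_Cons_def)

lemma finite_listset: "(\<And>A. A \<in> set As \<Longrightarrow> finite A) \<Longrightarrow> finite (listset As)"
  by (induction As) (auto simp: set_Cons_image)

lemma card_listset: "card (listset As) = (\<Prod>A\<leftarrow>As. card A)"
proof (induction As)
  case (Cons A As)
  have "inj_on (\<lambda>(x, xs). x # xs) (A \<times> listset As)" by (auto simp: inj_on_def)
  then show ?case using Cons by (simp add: set_Cons_image card_image card_cartesian_product)
qed simp

section \<open>Bhattacharyya coefficients of product sources\<close>

definition fiber :: "('a \<Rightarrow> 'b) \<Rightarrow> 'a set \<Rightarrow> 'b \<Rightarrow> 'a set" where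
  "fiber h A b = {x \<in> A. h x = b}"

text \<open>A fiber of \<open>map h\<close> in a product set is the product of the fibers in the
  coordinates, so the sum over output sequences factorises.\<close>

lemma sum_sqrt_card_fiber_listset:
  "(\<Sum>y\<in>seqs M (length As). sqrt (real (card (fiber (map h) (listset As) y)))) =
     (\<Prod>A\<leftarrow>As. \<Sum>b\<in>{1..M}. sqrt (real (card (fiber h A b))))"
proof (induction As)
  case Nil
  have "seqs M 0 = {[]}" by (auto simp: seqs_def)
  then show ?case by (simp add: fiber_def)
next
  case (Cons A As)
  have card: "card (fiber (map h) (listset (A # As)) (b # bs)) =
      card (fiber h A b) * card (fiber (map h) (listset As) bs)" for b bs
  proof -
    have "fiber (map h) (listset (A # As)) (b # bs) =
        (\<lambda>(x, xs). x # xs) ` (fiber h A b \<times> fiber (map h) (listset As) bs)"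
      by (auto simp: fiber_def set_Cons_image)
    moreover have "inj_on (\<lambda>(x, xs). x # xs) (fiber h A b \<times> fiber (map h) (listset As) bs)"
      by (auto simp: inj_on_def)
    ultimately show ?thesis by (simp only: card_image card_cartesian_product)
  qed
  have "inj_on (\<lambda>(b, bs). b # bs) ({1..M} \<times> seqs M (length As))" by (auto simp: inj_on_def)
  then have "(\<Sum>y\<in>seqs M (length (A # As)). sqrt (real (card (fiber (map h) (listset (A # As)) y)))) =
     (\<Sum>(b, bs)\<in>{1..M} \<times> seqs M (length As).
        sqrt (real (card (fiber h A b))) * sqrt (real (card (fiber (map h) (listset As) bs))))"
    by (simp add: seqs_Suc sum.reindex card real_sqrt_mult case_prod_unfold del: listset.simps)
  also have "\<dots> = (\<Sum>b\<in>{1..M}. sqrt (real (card (fiber h A b)))) *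
      (\<Sum>bs\<in>seqs M (length As). sqrt (real (card (fiber (map h) (listset As) bs))))"
    by (simp add: sum_product sum.cartesian_product)
  finally show ?case using Cons by simp
qed

text \<open>The Bhattacharyya coefficient of the uniform distribution on \<open>{1..M}\<close> and the law of
  \<open>h x\<close> for \<open>x\<close> uniform in \<open>A\<close>.\<close>
definition bhat :: "nat \<Rightarrow> ('a \<Rightarrow> nat) \<Rightarrow> 'a set \<Rightarrow> real" where
  "bhat M h A = (\<Sum>b\<in>{1..M}. sqrt (real (card (fiber h A b)))) / sqrt (real (card A) * real M)"

lemma bhat_nonneg: "0 \<le> bhat M h A"
  by (simp add: bhat_def sum_nonneg)

lemma pmf_map_pmf_of_set:
  assumes "finite A" "A \<noteq> {}"
  shows "pmf (map_pmf f (pmf_of_set A)) y = real (card (fiber f A y)) / real (card A)"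
  by (simp add: pmf_map measure_pmf_of_set assms fiber_def vimage_def Int_def)

text \<open>Multiplicativity of the Bhattacharyya coefficient for product distributions: the
  normalising factors, set sizes and powers of \<open>M\<close>, split over the coordinates as
  well.\<close>

lemma sum_sqrt_pmf_map_listset:
  assumes "\<And>A. A \<in> set As \<Longrightarrow> finite A \<and> A \<noteq> {}"
  shows "(\<Sum>y\<in>seqs M (length As).
           sqrt (pmf (map_pmf (map h) (pmf_of_set (listset As))) y * (1 / real M ^ length As))) =
         (\<Prod>A\<leftarrow>As. bhat M h A)"
proof -
  have fin: "finite (listset As)" using assms finite_listset by blast
  have "card (listset As) \<noteq> 0" using assms by (auto simp: card_listset prod_list_zero_iff)
  then have ne: "listset As \<noteq> {}" by auto
  have "(\<Sum>y\<in>seqs M (length As).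
      sqrt (pmf (map_pmf (map h) (pmf_of_set (listset As))) y * (1 / real M ^ length As))) =
    (\<Prod>A\<leftarrow>As. \<Sum>b\<in>{1..M}. sqrt (real (card (fiber h A b)))) /
      sqrt (real (card (listset As)) * real M ^ length As)"
    unfolding sum_sqrt_card_fiber_listset[symmetric] sum_divide_distrib
    by (simp add: pmf_map_pmf_of_set[OF fin ne] real_sqrt_divide real_sqrt_mult)
  also have "\<dots> = (\<Prod>A\<leftarrow>As. bhat M h A)"
    unfolding card_listset
  proof (induction As)
    case (Cons A As)
    let ?f = "\<lambda>A. \<Sum>b\<in>{1..M}. sqrt (real (card (fiber h A b)))"
    have eq: "(\<Prod>A\<leftarrow>A # As. ?f A) / sqrt (real (\<Prod>A\<leftarrow>A # As. card A) * real M ^ length (A # As)) =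
        bhat M h A * ((\<Prod>A\<leftarrow>As. ?f A) / sqrt (real (\<Prod>A\<leftarrow>As. card A) * real M ^ length As))"
      by (simp add: bhat_def real_sqrt_mult)
    show ?case unfolding eq Cons.IH by simp
  qed simp
  finally show ?thesis .
qed

text \<open>The coordinates are independent, so fixing a prefix leaves the next one uniform on a set
  of at least \<open>K\<close> elements, and no point mass exceeds \<open>1 / K\<close>.\<close>

lemma block_source_listset:
  assumes As: "\<And>A. A \<in> set As \<Longrightarrow> A \<subseteq> {1..N} \<and> K \<le> card A" and K: "K > 0"
  shows "block_source N (length As) (real K) (pmf_of_set (listset As))"
proof -
  have As': "finite A \<and> A \<noteq> {}" if "A \<in> set As" for A
    using As[OF that] K finite_subset[of A "{1..N}"] by auto
  have fin: "finite (listset As)" using As' finite_listset by blast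
  have "card (listset As) \<noteq> 0" using As' by (auto simp: card_listset prod_list_zero_iff)
  then have ne: "listset As \<noteq> {}" by auto
  have "listset As \<subseteq> seqs N (length As)"
    using As by (fastforce simp: listset_iff_nth seqs_def in_set_conv_nth)
  moreover have "cp (map_pmf (\<lambda>xs. xs ! i)
      (cond_pmf (pmf_of_set (listset As)) {xs. take i xs = p})) \<le> 1 / real K"
    if i: "i < length As" and p: "p \<in> set_pmf (map_pmf (take i) (pmf_of_set (listset As)))" for i p
  proof -
    define Q where "Q = listset As \<inter> {xs. take i xs = p}"
    have Q: "finite Q" "Q \<noteq> {}" using p fin ne by (auto simp: Q_def)
    have cond: "cond_pmf (pmf_of_set (listset As)) {xs. take i xs = p} = pmf_of_set Q"
      using Q fin ne by (intro pmf_eqI)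
        (auto simp: Q_def pmf_cond measure_pmf_of_set indicator_def Int_commute)
    \<comment> \<open>Overwriting entry \<open>i\<close> does not touch \<open>take i\<close>, which
      ends just before it. So the overwritten list stays in \<open>Q\<close>, and \<open>x\<close>
      itself need not lie in \<open>As ! i\<close>.\<close>
    have card_le: "card (fiber (\<lambda>xs. xs ! i) Q x) \<le> card (fiber (\<lambda>xs. xs ! i) Q x')"
      if "x' \<in> As ! i" for x x'
    proof (rule card_inj_on_le)
      show "inj_on (\<lambda>xs. xs[i := x']) (fiber (\<lambda>xs. xs ! i) Q x)"
      proof (rule inj_onI)
        fix xs ys assume *: "xs \<in> fiber (\<lambda>xs. xs ! i) Q x" "ys \<in> fiber (\<lambda>xs. xs ! i) Q x"
          "xs[i := x'] = ys[i := x']"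
        then have "xs[i := x', i := x] = ys[i := x', i := x]" by simp
        moreover have "xs ! i = x" "ys ! i = x" using *(1,2) by (auto simp: fiber_def)
        then have "xs[i := x] = xs" "ys[i := x] = ys" by (metis list_update_id)+
        ultimately show "xs = ys" by simp
      qed
      show "(\<lambda>xs. xs[i := x']) ` fiber (\<lambda>xs. xs ! i) Q x \<subseteq> fiber (\<lambda>xs. xs ! i) Q x'"
        using that i by (auto simp: fiber_def Q_def listset_iff_nth nth_list_update)
      show "finite (fiber (\<lambda>xs. xs ! i) Q x')" using Q by (simp add: fiber_def)
    qed
    have "pmf (map_pmf (\<lambda>xs. xs ! i) (pmf_of_set Q)) x \<le> 1 / real K" for x
    proof -
      have "K * card (fiber (\<lambda>xs. xs ! i) Q x) \<le> card (As ! i) * card (fiber (\<lambda>xs. xs ! i) Q x)"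
        using As[of "As ! i"] i by (intro mult_right_mono) auto
      also have "\<dots> = (\<Sum>x'\<in>As ! i. card (fiber (\<lambda>xs. xs ! i) Q x))" by simp
      also have "\<dots> \<le> (\<Sum>x'\<in>As ! i. card (fiber (\<lambda>xs. xs ! i) Q x'))"
        by (intro sum_mono card_le)
      also have "\<dots> = card (\<Union>x'\<in>As ! i. fiber (\<lambda>xs. xs ! i) Q x')"
        using As'[of "As ! i"] i Q
        by (intro card_UN_disjoint[symmetric]) (auto simp: fiber_def)
      also have "\<dots> \<le> card Q"
        using Q by (intro card_mono) (auto simp: fiber_def)
      finally have "real K * real (card (fiber (\<lambda>xs. xs ! i) Q x)) \<le> real (card Q)"
        by (simp only: of_nat_mult[symmetric] of_nat_le_iff)
      moreover have "card Q > 0" using Q by (simp add: card_gt_0_iff)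
      ultimately show ?thesis using K by (simp add: pmf_map_pmf_of_set[OF Q] field_simps)
    qed
    then show ?thesis unfolding cond using Q
      by (intro cp_le_of_pmf_le) auto
  qed
  ultimately show ?thesis by (simp add: block_source_def fin ne)
qed

section \<open>Hashing half of a set\<close>

text \<open>Quantifies the loss in concavity when \<open>n\<close> splits unevenly. With relative
  imbalance \<open>t\<close>, the square of the left side is
  \<open>n * (1 + sqrt (1 - t\<^sup>2))\<close>, and the bounds
  \<open>sqrt (1 - t\<^sup>2) \<le> 1 - t\<^sup>2 / 2\<close> and
  \<open>1 - t\<^sup>2 / 4 \<le> (1 - t\<^sup>2 / 8)\<^sup>2\<close> give the factor. For
  \<open>n = 0\<close> both sides are 0.\<close>

lemma sqrt_add_sqrt_le:
  fixes a n :: real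
  assumes "0 \<le> a" "a \<le> n"
  shows "sqrt a + sqrt (n - a) \<le> sqrt (2 * n) * (1 - (2 * a - n)\<^sup>2 / (8 * n\<^sup>2))"
proof (cases "n = 0")
  case False
  then have n: "n > 0" using assms by linarith
  define t where "t = (2 * a - n) / n"
  have a: "a = n * (1 + t) / 2" and na: "n - a = n * (1 - t) / 2"
    using n by (simp_all add: t_def field_simps)
  have t: "t\<^sup>2 \<le> 1"
    unfolding abs_square_le_1 using assms n by (simp add: t_def abs_le_iff field_simps)
  have "sqrt a * sqrt (n - a) = (n / 2) * sqrt (1 - t\<^sup>2)"
  proof -
    have "a * (n - a) = (n / 2)\<^sup>2 * (1 - t\<^sup>2)"
      unfolding a na by (simp add: field_simps power2_eq_square)
    then show ?thesis using n by (simp add: real_sqrt_mult[symmetric]) (simp add: real_sqrt_mult)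
  qed
  moreover have "sqrt (1 - t\<^sup>2) \<le> 1 - t\<^sup>2 / 2"
  proof (rule real_le_lsqrt)
    show "1 - t\<^sup>2 \<le> (1 - t\<^sup>2 / 2)\<^sup>2"
      using zero_le_power2[of "t\<^sup>2 / 2"] by (simp add: power2_diff)
  qed (use t in auto)
  ultimately have *: "sqrt a * sqrt (n - a) \<le> (n / 2) * (1 - t\<^sup>2 / 2)"
    using n by simp
  have "(sqrt a + sqrt (n - a))\<^sup>2 = n + 2 * (sqrt a * sqrt (n - a))"
    using assms by (simp add: power2_sum)
  also have "\<dots> \<le> n + 2 * ((n / 2) * (1 - t\<^sup>2 / 2))" using * by linarith
  also have "\<dots> = 2 * n * (1 - t\<^sup>2 / 4)" by (simp add: field_simps)
  also have "\<dots> \<le> 2 * n * (1 - t\<^sup>2 / 8)\<^sup>2"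
  proof (rule mult_left_mono)
    show "1 - t\<^sup>2 / 4 \<le> (1 - t\<^sup>2 / 8)\<^sup>2"
      using zero_le_power2[of "t\<^sup>2 / 8"] by (simp add: power2_diff)
  qed (use n in auto)
  also have "\<dots> = (sqrt (2 * n) * (1 - t\<^sup>2 / 8))\<^sup>2"
    using n by (simp add: power_mult_distrib)
  finally have "sqrt a + sqrt (n - a) \<le> sqrt (2 * n) * (1 - t\<^sup>2 / 8)"
    using t n by (auto intro: power2_le_imp_le)
  then show ?thesis by (simp add: t_def power_divide mult.commute)
qed (use assms in auto)

text \<open>The first summand on the right exceeds the Bhattacharyya term \<open>sqrt (q / M)\<close> by
  \<open>(1 - sqrt (M * q))\<^sup>2 / (2 * M)\<close>, which suffices unless \<open>q\<close> is close to \<open>1 / M\<close>; in that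
  case the variance term on the left does.\<close>
lemma bhat_term_bound:
  fixes q M K :: real
  assumes q: "0 \<le> q" "q \<le> 1" and M: "2 \<le> M" and K: "0 < K" "M \<le> 2 * K"
  shows "sqrt (q / M) * (1 - (1 - q) / (16 * K * q)) \<le> (1 / M + q) / 2 - 1 / (100 * K)"
proof -
  define s where "s = sqrt (M * q)"
  have s0: "s \<ge> 0" using q M by (simp add: s_def)
  have qs: "q = s\<^sup>2 / M" using q M by (simp add: s_def)
  have sq: "sqrt (q / M) = s / M"
    unfolding qs using M s0 by (simp add: real_sqrt_divide)
  have KM: "1 / (100 * K) \<le> 1 / (50 * M)" using K M by (simp add: field_simps)
  have eq: "(1 / M + q) / 2 = s / M + (1 - s)\<^sup>2 / (2 * M)"
    unfolding qs using M by (simp add: field_simps power2_eq_square)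
  show ?thesis
  \<comment> \<open>At this cutoff the gain \<open>(1 - s)\<^sup>2 / (2 * M)\<close> is at least
    \<open>1 / (50 * M)\<close>, which suffices by \<open>M \<le> 2 * K\<close>.\<close>
  proof (cases "1 / 25 \<le> (1 - s)\<^sup>2")
    case True
    have "s / M * (1 - (1 - q) / (16 * K * q)) \<le> s / M * 1"
      using s0 M q K by (intro mult_left_mono) auto
    moreover have "1 / (50 * M) \<le> (1 - s)\<^sup>2 / (2 * M)"
      using True M by (simp add: field_simps)
    ultimately show ?thesis unfolding eq sq using KM by linarith
  next
    case False
    then have "(1 - s)\<^sup>2 < (1 / 5)\<^sup>2" by (simp add: power2_eq_square)
    then have "\<bar>1 - s\<bar> < 1 / 5" using power_less_imp_less_base[of "\<bar>1 - s\<bar>" 2 "1/5"] by simp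
    then have s: "s > 4 / 5" "s < 6 / 5" by linarith+
    have "s\<^sup>2 \<le> (6 / 5)\<^sup>2" using s by (intro power_mono) auto
    \<comment> \<open>\<open>M \<ge> 2\<close> keeps \<open>q\<close> away from 1, so that the
      variance factor \<open>1 - q\<close> is bounded below.\<close>
    then have "q \<le> (6 / 5)\<^sup>2 / 2"
      unfolding qs using M by (intro frac_le) auto
    then have q1: "7 / 25 \<le> 1 - q" by (simp add: power2_eq_square)
    have "1 / (100 * K) \<le> (7 / 25) / (16 * K * (6 / 5))" using K by (simp add: field_simps)
    also have "\<dots> \<le> (1 - q) / (16 * K * s)"
      using q1 K s by (intro frac_le mult_left_mono) auto
    also have "\<dots> = s / M * ((1 - q) / (16 * K * q))"
      using s M K by (subst (2) qs) (simp add: field_simps power2_eq_square)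
    finally have "s / M * (1 - (1 - q) / (16 * K * q)) \<le> s / M - 1 / (100 * K)"
      by (simp only: right_diff_distrib mult_1_right)
    moreover have "0 \<le> (1 - s)\<^sup>2 / (2 * M)" using M by simp
    ultimately show ?thesis unfolding eq sq by linarith
  qed
qed

text \<open>Four times the hypergeometric variance, summed over \<open>F\<close>. Writing the
  deviation as a sum of signs \<open>e A i\<close> reduces it to pair correlations, which are all
  equal by symmetry and are determined by the signs of a half set adding up to zero.\<close>

lemma sum_signs_square:
  fixes K :: nat
  assumes K: "K > 0" and S: "S \<subseteq> {1..2 * K}"
  defines "F \<equiv> {A. A \<subseteq> {1..2 * K} \<and> card A = K}"
  shows "(\<Sum>A\<in>F. (2 * real (card (S \<inter> A)) - real (card S))\<^sup>2) =
     real (card F) * (real (card S) * (2 * real K - real (card S)) / (2 * real K - 1))"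
proof -
  define e where "e = (\<lambda>A (i::nat). if i \<in> A then 1 else (-1::real))"
  have e_sq: "e A i * e A i = 1" for A i by (simp add: e_def)
  have finS: "finite S" using S finite_subset by blast
  have finF: "finite F" unfolding F_def by (rule finite_subset[of _ "Pow {1..2 * K}"]) auto
  have sum_e: "(\<Sum>i\<in>R. e A i) = 2 * real (card (R \<inter> A)) - real (card R)" if "finite R" for R A
  proof -
    have "(\<Sum>i\<in>R. e A i) = (\<Sum>i\<in>R. 2 * indicator A i - 1)"
      by (intro sum.cong) (auto simp: e_def)
    also have "\<dots> = 2 * (\<Sum>i\<in>R. indicator A i) - real (card R)"
      by (simp add: sum_subtractf sum_distrib_left)
    also have "(\<Sum>i\<in>R. indicator A i) = real (card (R \<inter> A))"
      using that by (simp add: sum.If_cases indicator_def)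
    finally show ?thesis .
  qed
  \<comment> \<open>Transposing \<open>j\<close> and \<open>k\<close> permutes \<open>F\<close> and
    fixes \<open>i\<close>.\<close>
  have sym: "(\<Sum>A\<in>F. e A i * e A j) = (\<Sum>A\<in>F. e A i * e A k)"
    if "j \<noteq> i" "k \<noteq> i" "j \<in> {1..2 * K}" "k \<in> {1..2 * K}" for i j k
  proof -
    let ?t = "Transposition.transpose j k"
    have img: "?t ` A \<in> F" if "A \<in> F" for A
    proof -
      have "?t x \<in> {1..2 * K}" if "x \<in> {1..2 * K}" for x
        using that \<open>j \<in> {1..2 * K}\<close> \<open>k \<in> {1..2 * K}\<close> by (auto simp: Transposition.transpose_def)
      then show ?thesis using that unfolding F_def by (auto simp: card_image)
    qed
    show ?thesis
      by (rule sum.reindex_bij_witness[where i = "image ?t" and j = "image ?t"])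
        (use that img in \<open>auto simp: e_def image_image in_transpose_image_iff
          Transposition.transpose_def\<close>)
  qed
  have cross: "(\<Sum>A\<in>F. e A i * e A j) = - real (card F) / (2 * real K - 1)"
    if ij: "i \<noteq> j" "i \<in> {1..2 * K}" "j \<in> {1..2 * K}" for i j
  proof -
    \<comment> \<open>A set in \<open>F\<close> contains exactly half of the points, so its signs
      cancel. Multiplying by \<open>e A i\<close> and expanding leaves one diagonal term and
      \<open>2 * K - 1\<close> equal cross terms.\<close>
    have "0 = (\<Sum>A\<in>F. e A i * (\<Sum>k\<in>{1..2 * K}. e A k))"
      by (rule sum.neutral[symmetric]) (auto simp: sum_e F_def Int_absorb1)
    also have "\<dots> = (\<Sum>k\<in>{1..2 * K}. \<Sum>A\<in>F. e A i * e A k)"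
      unfolding sum_distrib_left by (rule sum.swap)
    also have "\<dots> = (\<Sum>A\<in>F. e A i * e A i) + (\<Sum>k\<in>{1..2 * K} - {i}. \<Sum>A\<in>F. e A i * e A k)"
      using ij by (subst sum.remove[of _ i]) auto
    also have "(\<Sum>k\<in>{1..2 * K} - {i}. \<Sum>A\<in>F. e A i * e A k) =
        (\<Sum>k\<in>{1..2 * K} - {i}. \<Sum>A\<in>F. e A i * e A j)"
      using ij by (intro sum.cong refl sym) auto
    also have "\<dots> = (2 * real K - 1) * (\<Sum>A\<in>F. e A i * e A j)"
      using ij K by (simp add: card_Diff_singleton of_nat_diff)
    also have "(\<Sum>A\<in>F. e A i * e A i) = real (card F)"
      by (simp add: e_sq)
    finally show ?thesis using K by (simp add: field_simps)
  qed
  have "(\<Sum>A\<in>F. (2 * real (card (S \<inter> A)) - real (card S))\<^sup>2) = (\<Sum>A\<in>F. \<Sum>i\<in>S. \<Sum>j\<in>S. e A i * e A j)"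
    by (simp add: sum_e[OF finS, symmetric] power2_eq_square sum_product)
  also have "\<dots> = (\<Sum>i\<in>S. \<Sum>j\<in>S. \<Sum>A\<in>F. e A i * e A j)"
    by (subst sum.swap) (intro sum.cong refl sum.swap)
  also have "\<dots> = (\<Sum>i\<in>S. real (card F) - real (card S - 1) * (real (card F) / (2 * real K - 1)))"
  proof (intro sum.cong refl)
    fix i assume i: "i \<in> S"
    have "(\<Sum>j\<in>S. \<Sum>A\<in>F. e A i * e A j) =
        (\<Sum>A\<in>F. e A i * e A i) + (\<Sum>j\<in>S - {i}. \<Sum>A\<in>F. e A i * e A j)"
      using i finS by (subst sum.remove[of _ i]) auto
    also have "(\<Sum>j\<in>S - {i}. \<Sum>A\<in>F. e A i * e A j) = (\<Sum>j\<in>S - {i}. - real (card F) / (2 * real K - 1))"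
      using i S by (intro sum.cong refl cross) auto
    also have "(\<Sum>A\<in>F. e A i * e A i) = real (card F)"
      by (simp add: e_sq)
    finally show "(\<Sum>j\<in>S. \<Sum>A\<in>F. e A i * e A j) =
        real (card F) - real (card S - 1) * (real (card F) / (2 * real K - 1))"
      using i finS by (simp add: card_Diff_singleton)
  qed
  also have "\<dots> = real (card F) * (real (card S) * (2 * real K - real (card S)) / (2 * real K - 1))"
  proof (cases "S = {}")
    case False
    then have "card S > 0" using finS by (simp add: card_gt_0_iff)
    moreover have "2 * real K - 1 > 0" using K by linarith
    ultimately show ?thesis by (simp add: of_nat_diff field_simps)
  qed simp
  finally show ?thesis .
qed

text \<open>Pairing \<open>A\<close> with its complement splits every bucket of
  \<open>{1..2 * K}\<close> in two. The mean squared imbalance of the split is the variance above,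
  so a bucket with share \<open>q = n b / (2 * K)\<close> contributes on average at most
  \<open>(1 / M + q) / 2 - 1 / (100 * K)\<close>. The shares add up to 1, and the \<open>M\<close>
  losses add up to \<open>M / (100 * K)\<close>.\<close>

lemma sum_bhat_half_subsets:
  fixes K M :: nat
  assumes K: "K > 0" and M: "2 \<le> M" "M \<le> 2 * K" and h: "h ` {1..2 * K} \<subseteq> {1..M}"
  defines "F \<equiv> {A. A \<subseteq> {1..2 * K} \<and> card A = K}"
  shows "(\<Sum>A\<in>F. bhat M h A) \<le> (1 - M / (100 * real K)) * card F"
proof -
  define I where "I = {1..2 * K}"
  define n where "n = (\<lambda>b. real (card (fiber h I b)))"
  have card_I: "card I = 2 * K" by (simp add: I_def)
  have finF: "finite F" unfolding F_def by (rule finite_subset[of _ "Pow {1..2 * K}"]) auto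
  have per_b: "(\<Sum>A\<in>F. sqrt (card (fiber h A b)) + sqrt (card (fiber h (I - A) b))) / (2 * sqrt (real K * real M))
     \<le> card F * ((1 / M + n b / (2 * K)) / 2 - 1 / (100 * real K))" for b
  proof -
    define S where "S = fiber h I b"
    have S: "S \<subseteq> {1..2 * K}" by (auto simp: S_def fiber_def I_def)
    have finS: "finite S" using S finite_subset by blast
    have n: "n b = card S" by (simp add: n_def S_def)
    have nK: "n b \<le> 2 * K" using card_mono[OF _ S] by (simp add: n)
    have "(\<Sum>A\<in>F. sqrt (card (fiber h A b)) + sqrt (card (fiber h (I - A) b))) \<le>
       (\<Sum>A\<in>F. sqrt (2 * n b) * (1 - (2 * card (S \<inter> A) - n b)\<^sup>2 / (8 * (n b)\<^sup>2)))"
    proof (rule sum_mono)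
      fix A assume "A \<in> F"
      then have A: "A \<subseteq> I" by (auto simp: F_def I_def)
      have 1: "fiber h A b = S \<inter> A" using A by (auto simp: S_def fiber_def)
      have 2: "fiber h (I - A) b = S - S \<inter> A" using A by (auto simp: S_def fiber_def)
      have le: "card (S \<inter> A) \<le> card S" using finS by (intro card_mono) auto
      have 3: "real (card (S - S \<inter> A)) = n b - card (S \<inter> A)"
        using finS le by (simp add: card_Diff_subset n of_nat_diff)
      show "sqrt (card (fiber h A b)) + sqrt (card (fiber h (I - A) b)) \<le>
          sqrt (2 * n b) * (1 - (2 * card (S \<inter> A) - n b)\<^sup>2 / (8 * (n b)\<^sup>2))"
        using sqrt_add_sqrt_le[of "card (S \<inter> A)" "n b"] le unfolding 1 2 3 by (simp add: n)
    qed
    also have "\<dots> = sqrt (2 * n b) * (card F - (\<Sum>A\<in>F. (2 * card (S \<inter> A) - n b)\<^sup>2) / (8 * (n b)\<^sup>2))"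
      by (simp add: sum_distrib_left[symmetric] sum_subtractf sum_divide_distrib)
    also have "(\<Sum>A\<in>F. (2 * card (S \<inter> A) - n b)\<^sup>2) = card F * (n b * (2 * real K - n b) / (2 * real K - 1))"
      using sum_signs_square[OF K S] by (simp add: F_def n)
    \<comment> \<open>Replacing \<open>2 * K - 1\<close> by \<open>2 * K\<close> only lowers the
      subtracted term and turns the variance into an expression in the share
      \<open>n b / (2 * K)\<close>.\<close>
    also have "sqrt (2 * n b) * (card F - card F * (n b * (2 * real K - n b) / (2 * real K - 1)) / (8 * (n b)\<^sup>2)) \<le>
        sqrt (2 * n b) * (card F - card F * ((n b * (2 * real K - n b) / (2 * K)) / (8 * (n b)\<^sup>2)))"
    proof -
      have "n b * (2 * real K - n b) / (2 * K) \<le> n b * (2 * real K - n b) / (2 * real K - 1)"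
        using K nK by (intro divide_left_mono) (auto simp: n)
      then have "(n b * (2 * real K - n b) / (2 * K)) / (8 * (n b)\<^sup>2) \<le> (n b * (2 * real K - n b) / (2 * real K - 1)) / (8 * (n b)\<^sup>2)"
        by (intro divide_right_mono) auto
      then have "card F * ((n b * (2 * real K - n b) / (2 * K)) / (8 * (n b)\<^sup>2)) \<le> card F * ((n b * (2 * real K - n b) / (2 * real K - 1)) / (8 * (n b)\<^sup>2))"
        by (intro mult_left_mono) auto
      then show ?thesis by (intro mult_left_mono) (auto simp: n)
    qed
    \<comment> \<open>This is the shape of \<open>bhat_term_bound\<close>. For an empty bucket the
      factor \<open>sqrt (2 * n b)\<close> makes both sides 0, whatever the quotients by 0
      are.\<close>
    also have "\<dots> = card F * (sqrt (2 * n b) * (1 - (1 - n b / (2 * K)) / (16 * K * (n b / (2 * K)))))"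
      using K by (cases "n b = 0") (auto simp: field_simps power2_eq_square)
    finally have "(\<Sum>A\<in>F. sqrt (card (fiber h A b)) + sqrt (card (fiber h (I - A) b))) / (2 * sqrt (real K * real M))
      \<le> \<dots> / (2 * sqrt (real K * real M))"
      by (rule divide_right_mono) simp
    also have "\<dots> = card F * ((sqrt (2 * n b) / (2 * sqrt (real K * real M))) * (1 - (1 - n b / (2 * K)) / (16 * K * (n b / (2 * K)))))"
      by simp
    also have "sqrt (2 * n b) / (2 * sqrt (real K * real M)) = sqrt (n b / (2 * K) / M)"
    proof -
      have "sqrt (n b / (2 * K) / M) = sqrt (2 * n b / (2\<^sup>2 * (real K * real M)))"
        by (simp add: field_simps)
      also have "\<dots> = sqrt (2 * n b) / (2 * sqrt (real K * real M))"
        unfolding real_sqrt_divide by (simp only: real_sqrt_mult real_sqrt_abs abs_numeral)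
      finally show ?thesis by simp
    qed
    also have "sqrt (n b / (2 * K) / M) * (1 - (1 - n b / (2 * K)) / (16 * K * (n b / (2 * K))))
       \<le> (1 / M + n b / (2 * K)) / 2 - 1 / (100 * real K)"
    proof -
      have "0 \<le> n b / (2 * K)" "n b / (2 * K) \<le> 1" using K nK by (auto simp: n)
      then show ?thesis using bhat_term_bound[of "n b / (2 * K)" "real M" "real K"] K M by simp
    qed
    finally show ?thesis by (simp add: mult_left_mono)
  qed
  have F_I: "F = {A. A \<subseteq> I \<and> card A = K}" by (simp add: F_def I_def)
  have diff: "I - A \<in> F" "I - (I - A) = A" if "A \<in> F" for A
  proof -
    have A: "A \<subseteq> I" "card A = K" using that by (auto simp: F_I)
    then have "finite A" using finite_subset[of A I] by (simp add: I_def)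
    then have "card (I - A) = K" using A by (simp add: card_Diff_subset card_I)
    then show "I - A \<in> F" by (simp add: F_I)
    show "I - (I - A) = A" using A(1) by blast
  qed
  have compl: "(\<Sum>A\<in>F. bhat M h A) = (\<Sum>A\<in>F. bhat M h (I - A))"
    by (rule sum.reindex_bij_witness[where i = "\<lambda>A. I - A" and j = "\<lambda>A. I - A"]) (simp_all add: diff)
  have "2 * (\<Sum>A\<in>F. bhat M h A) = (\<Sum>A\<in>F. bhat M h A + bhat M h (I - A))"
    using compl by (simp add: sum.distrib)
  also have "\<dots> = (\<Sum>A\<in>F. \<Sum>b\<in>{1..M}. (sqrt (card (fiber h A b)) + sqrt (card (fiber h (I - A) b))) / sqrt (real K * real M))"
  proof (intro sum.cong refl)
    fix A assume "A \<in> F"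
    then have "card A = K" "card (I - A) = K" using diff(1) by (auto simp: F_I)
    then show "bhat M h A + bhat M h (I - A) =
        (\<Sum>b\<in>{1..M}. (sqrt (card (fiber h A b)) + sqrt (card (fiber h (I - A) b))) / sqrt (real K * real M))"
      by (simp add: bhat_def sum.distrib add_divide_distrib sum_divide_distrib)
  qed
  also have "\<dots> = 2 * (\<Sum>b\<in>{1..M}. (\<Sum>A\<in>F. sqrt (card (fiber h A b)) + sqrt (card (fiber h (I - A) b))) / (2 * sqrt (real K * real M)))"
    by (subst sum.swap, subst sum_distrib_left, intro sum.cong refl)
      (simp add: sum_divide_distrib[symmetric])
  finally have "(\<Sum>A\<in>F. bhat M h A) =
     (\<Sum>b\<in>{1..M}. (\<Sum>A\<in>F. sqrt (card (fiber h A b)) + sqrt (card (fiber h (I - A) b))) / (2 * sqrt (real K * real M)))"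
    by simp
  also have "\<dots> \<le> (\<Sum>b\<in>{1..M}. card F * ((1 / M + n b / (2 * K)) / 2 - 1 / (100 * real K)))"
    by (intro sum_mono per_b)
  also have "\<dots> = card F * ((1 + (\<Sum>b\<in>{1..M}. n b) / (2 * K)) / 2 - M / (100 * real K))"
    using M by (simp add: sum_distrib_left[symmetric] sum_subtractf sum.distrib sum_divide_distrib[symmetric])
  also have "(\<Sum>b\<in>{1..M}. n b) = 2 * K"
  proof -
    have "(\<Sum>b\<in>{1..M}. card (fiber h I b)) = card (\<Union>b\<in>{1..M}. fiber h I b)"
      by (rule card_UN_disjoint[symmetric]) (auto simp: fiber_def I_def)
    also have "(\<Union>b\<in>{1..M}. fiber h I b) = I" using h by (auto simp: fiber_def I_def)
    finally show ?thesis by (simp add: n_def card_I of_nat_sum[symmetric] del: of_nat_sum)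
  qed
  finally show ?thesis using K by (simp add: mult.commute)
qed

section \<open>Choosing the source\<close>

text \<open>Method of conditional expectations: the sets are chosen one at a time, and the factors
  already collected are absorbed into the weights. Since the average over \<open>F\<close> is at
  most \<beta> for each \<open>h\<close> separately, it stays so under any weights, and one list
  serves the whole family.\<close>

lemma exists_list_sum_prod_le:
  fixes w :: "'h \<Rightarrow> real" and g :: "'h \<Rightarrow> 'a \<Rightarrow> real" and \<beta> :: real
  assumes F: "finite F" "F \<noteq> {}" and \<beta>: "\<beta> \<ge> 0"
    and w: "\<And>h. h \<in> R \<Longrightarrow> 0 \<le> w h" and g: "\<And>h A. 0 \<le> g h A"
    and avg: "\<And>h. h \<in> R \<Longrightarrow> (\<Sum>A\<in>F. g h A) \<le> \<beta> * card F"
  shows "\<exists>As. length As = T \<and> set As \<subseteq> F \<and>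
    (\<Sum>h\<in>R. w h * (\<Prod>A\<leftarrow>As. g h A)) \<le> \<beta> ^ T * (\<Sum>h\<in>R. w h)"
proof (induction T)
  case 0
  show ?case by (intro exI[of _ "[]"]) simp
next
  case (Suc T)
  then obtain As where As: "length As = T" "set As \<subseteq> F"
    and le: "(\<Sum>h\<in>R. w h * (\<Prod>A\<leftarrow>As. g h A)) \<le> \<beta> ^ T * (\<Sum>h\<in>R. w h)" by auto
  define v where "v = (\<lambda>h. w h * (\<Prod>A\<leftarrow>As. g h A))"
  have prod0: "0 \<le> (\<Prod>A\<leftarrow>As. g h A)" for h
    by (rule prod_list_nonneg) (use g in auto)
  then have v: "0 \<le> v h" if "h \<in> R" for h using w that by (simp add: v_def)
  have "(\<Sum>A\<in>F. \<Sum>h\<in>R. v h * g h A) = (\<Sum>h\<in>R. v h * (\<Sum>A\<in>F. g h A))"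
    by (subst sum.swap) (simp add: sum_distrib_left)
  also have "\<dots> \<le> (\<Sum>h\<in>R. v h * (\<beta> * card F))"
    by (intro sum_mono mult_left_mono avg v)
  also have "\<dots> = (\<Sum>A\<in>F. \<beta> * (\<Sum>h\<in>R. v h))"
    unfolding sum_distrib_right[symmetric] by simp
  \<comment> \<open>If every choice exceeded the bound, so would the sum over
    \<open>F\<close>.\<close>
  finally have "\<not> (\<forall>A\<in>F. \<beta> * (\<Sum>h\<in>R. v h) < (\<Sum>h\<in>R. v h * g h A))"
    using sum_strict_mono[OF F, of "\<lambda>_. \<beta> * (\<Sum>h\<in>R. v h)" "\<lambda>A. \<Sum>h\<in>R. v h * g h A"] by force
  then obtain A where A: "A \<in> F" "(\<Sum>h\<in>R. v h * g h A) \<le> \<beta> * (\<Sum>h\<in>R. v h)"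
    by (auto simp: not_less)
  note A(2)
  also have "\<beta> * (\<Sum>h\<in>R. v h) \<le> \<beta> * (\<beta> ^ T * (\<Sum>h\<in>R. w h))"
    using le \<beta> by (intro mult_left_mono) (auto simp: v_def)
  finally have "(\<Sum>h\<in>R. w h * (\<Prod>A\<leftarrow>A # As. g h A)) \<le> \<beta> ^ Suc T * (\<Sum>h\<in>R. w h)"
    by (simp add: v_def mult_ac)
  then show ?case using As A(1) by (intro exI[of _ "A # As"]) auto
qed

text \<open>Cauchy-Schwarz over the buckets that are hit. It serves the degenerate ranges, where the
  image misses a constant fraction of the buckets.\<close>

lemma bhat_le_sqrt_card:
  assumes A: "finite A" "A \<noteq> {}" and B: "h ` A \<subseteq> B" "B \<subseteq> {1..M}"
  shows "bhat M h A \<le> sqrt (real (card B) / real M)"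
proof -
  have finB: "finite B" using B(2) finite_subset by blast
  have cA: "card A > 0" using A by (simp add: card_gt_0_iff)
  have "(\<Sum>b\<in>{1..M}. sqrt (real (card (fiber h A b)))) = (\<Sum>b\<in>B. 1 * sqrt (real (card (fiber h A b))))"
  proof (intro sum.mono_neutral_cong_right ballI)
    fix b assume "b \<in> {1..M} - B"
    then have "fiber h A b = {}" using B(1) by (auto simp: fiber_def)
    then show "sqrt (real (card (fiber h A b))) = 0" by simp
  qed (use B in auto)
  also have "\<dots> \<le> sqrt ((\<Sum>b\<in>B. 1\<^sup>2) * (\<Sum>b\<in>B. (sqrt (real (card (fiber h A b))))\<^sup>2))"
    by (intro real_le_rsqrt Cauchy_Schwarz_ineq_sum)
  also have "(\<Sum>b\<in>B. (sqrt (real (card (fiber h A b))))\<^sup>2) = real (card (\<Union>b\<in>B. fiber h A b))"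
    using A finB by (subst card_UN_disjoint) (auto simp: fiber_def)
  also have "(\<Union>b\<in>B. fiber h A b) = A" using B by (auto simp: fiber_def)
  finally have "bhat M h A \<le> sqrt (real (card B) * real (card A)) / sqrt (real (card A) * real M)"
    unfolding bhat_def by (intro divide_right_mono) auto
  also have "\<dots> = sqrt (real (card B) / real M)"
    using cA by (simp add: real_sqrt_mult real_sqrt_divide)
  finally show ?thesis .
qed

text \<open>Instance of \<open>hashed_far\<close> for product sources, with the Bhattacharyya sums
  factored over the blocks.\<close>

lemma far_listset:
  fixes D \<alpha> \<delta> B :: real
  assumes fam: "hash_family N M \<H>" "\<H> \<noteq> {#}" "real (size \<H>) \<le> D"
    and M: "M > 0" and \<delta>: "\<delta> > 0" and \<alpha>: "\<alpha> \<ge> 1"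
    and As: "length As = T" "\<And>A. A \<in> set As \<Longrightarrow> A \<subseteq> {1..N} \<and> A \<noteq> {}"
    and B: "(\<Sum>h\<in>set_mset \<H>. pmf (pmf_of_multiset \<H>) h * (\<Prod>A\<leftarrow>As. bhat M h A)) \<le> B"
    and num: "16 * D * \<alpha> * B\<^sup>2 \<le> \<delta> ^ 4"
  defines "X \<equiv> pmf_of_set (listset As)"
  shows "(\<forall>Z. set_pmf Z \<subseteq> seqs M T \<longrightarrow> cp Z \<le> \<alpha> / real M ^ T \<longrightarrow> far (1 - \<delta>) (hashed \<H> X) Z) \<and>
    far (1 - \<delta>) (hashed \<H> X) (pmf_of_set (seqs M T))"
proof -
  have As': "finite A \<and> A \<noteq> {}" if "A \<in> set As" for A
    using As(2)[OF that] finite_subset[of A "{1..N}"] by auto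
  have fin: "finite (listset As)" using As' finite_listset by blast
  have "card (listset As) \<noteq> 0" using As' by (auto simp: card_listset prod_list_zero_iff)
  then have ne: "listset As \<noteq> {}" by auto
  have img: "set_pmf (map_pmf (map h) X) \<subseteq> seqs M T" if "h \<in># \<H>" for h
  proof -
    have "h x \<in> {1..M}" if "x \<in> {1..N}" for x
      using fam(1) \<open>h \<in># \<H>\<close> that by (auto simp: hash_family_def PiE_iff)
    then have "h (xs ! i) \<in> {1..M}" if "xs \<in> listset As" "i < length As" for xs i
      using that As(2)[of "As ! i"] by (auto simp: listset_iff_nth subset_eq)
    then show ?thesis using As(1)
      by (auto simp: X_def fin ne seqs_def listset_iff_nth in_set_conv_nth)
  qed
  have far: "far (1 - \<delta>) (hashed \<H> X) Z"
    if "set_pmf Z \<subseteq> seqs M T" "cp Z \<le> \<alpha> / real M ^ T" for Z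
    by (rule hashed_far[where D = D and B = B and M = M and T = T and \<alpha> = \<alpha>])
      (use fam M \<delta> \<alpha> img num that B sum_sqrt_pmf_map_listset[of As _ M] As' As(1)
        in \<open>auto simp: X_def\<close>)
  have "card (seqs M T) \<noteq> 0" using M by (simp add: card_seqs)
  then have "seqs M T \<noteq> {}" by auto
  \<comment> \<open>The uniform distribution is an admissible \<open>Z\<close>: its collision
    probability is \<open>1 / M ^ T\<close>, and \<open>\<alpha> \<ge> 1\<close>.\<close>
  then have "far (1 - \<delta>) (hashed \<H> X) (pmf_of_set (seqs M T))"
    using M \<alpha> by (intro far) (auto simp: finite_seqs cp_uniform_seqs divide_right_mono)
  with far show ?thesis by blast
qed

section \<open>Constant and randomly chosen block sets, and the parameter estimates\<close>

lemma sum_pmf_of_multiset: "\<H> \<noteq> {#} \<Longrightarrow> (\<Sum>h\<in>set_mset \<H>. pmf (pmf_of_multiset \<H>) h) = 1"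
  by (rule sum_pmf_eq_1) auto

text \<open>A constant loss per block makes \<open>B\<^sup>2 = (2 / 3) ^ T\<close>, which decays
  like the eighth power of \<open>exp (- T / 32)\<close>. The hypothesis relating \<alpha>,
  \<open>d\<close> and \<open>T\<close> then provides the rest.\<close>

lemma far_replicate:
  fixes \<alpha> \<delta> d :: real
  assumes fam: "hash_family N M \<H>" "\<H> \<noteq> {#}" "real (size \<H>) \<le> 2 powr d"
    and M: "M > 0" and \<delta>: "\<delta> > 0" "\<delta> < 1" and \<alpha>: "\<alpha> > 1" and d: "d > 0"
    and T: "\<alpha> * 2 powr d < \<delta> ^ 3 * exp (real T / 32) / 128"
    and A: "A \<subseteq> {1..N}" "A \<noteq> {}"
    and bhat: "\<And>h. h \<in># \<H> \<Longrightarrow> bhat M h A \<le> sqrt (2 / 3)"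
  defines "X \<equiv> pmf_of_set (listset (replicate T A))"
  shows "(\<forall>Z. set_pmf Z \<subseteq> seqs M T \<longrightarrow> cp Z \<le> \<alpha> / real M ^ T \<longrightarrow> far (1 - \<delta>) (hashed \<H> X) Z) \<and>
    far (1 - \<delta>) (hashed \<H> X) (pmf_of_set (seqs M T))"
  unfolding X_def
proof (rule far_listset[OF fam M])
  show "(\<Sum>h\<in>set_mset \<H>. pmf (pmf_of_multiset \<H>) h * (\<Prod>A\<leftarrow>replicate T A. bhat M h A)) \<le> sqrt (2 / 3) ^ T"
  proof -
    have "(\<Sum>h\<in>set_mset \<H>. pmf (pmf_of_multiset \<H>) h * (\<Prod>A\<leftarrow>replicate T A. bhat M h A)) \<le>
        (\<Sum>h\<in>set_mset \<H>. pmf (pmf_of_multiset \<H>) h * sqrt (2 / 3) ^ T)"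
      unfolding map_replicate prod_list_replicate
      by (intro sum_mono mult_left_mono power_mono bhat bhat_nonneg) auto
    then show ?thesis by (simp only: sum_distrib_right[symmetric] sum_pmf_of_multiset[OF fam(2)] mult_1_left)
  qed
  define E where "E = exp (real T / 32)"
  have E1: "E \<ge> 1" by (simp add: E_def)
  have "1 * 1 \<le> \<alpha> * 2 powr d" using \<alpha> d by (intro mult_mono ge_one_powr_ge_zero) auto
  then have "128 < \<delta> ^ 3 * E" using T by (simp add: E_def)
  also have "\<dots> \<le> \<delta> ^ 1 * E" using \<delta> E1 by (intro mult_right_mono power_decreasing) auto
  also have "\<dots> \<le> \<delta> * E ^ 7" using \<delta> E1 self_le_power[of E 7] by simp
  finally have E7: "1 \<le> 8 * (\<delta> * E ^ 7)" by simp
  \<comment> \<open>From \<open>2 / 3 \<le> 3 / 4 \<le> exp (- 1 / 4)\<close>.\<close>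
  have "(2 / 3 :: real) ^ T \<le> exp (- (1 / 4)) ^ T"
    using exp_ge_add_one_self[of "- (1 / 4) :: real"] by (intro power_mono) auto
  also have "exp (- (1 / 4)) ^ T = 1 / E ^ 8"
    by (simp add: E_def exp_of_nat_mult[symmetric] exp_minus field_simps)
  finally have le: "(2 / 3 :: real) ^ T \<le> 1 / E ^ 8" .
  have "16 * 2 powr d * \<alpha> * (sqrt (2 / 3) ^ T)\<^sup>2 = 16 * (\<alpha> * 2 powr d) * (2 / 3) ^ T"
    by (simp add: power_mult[symmetric] mult.commute[of T 2]) (simp add: power_mult power_divide)
  also have "\<dots> \<le> 16 * (\<delta> ^ 3 * E / 128) * (1 / E ^ 8)"
    using T \<alpha> \<delta> le by (intro mult_mono) (auto simp: E_def)
  also have "\<dots> = \<delta> ^ 3 * 1 / (8 * E ^ 7)"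
    using E1 by (simp add: field_simps eval_nat_numeral)
  also have "\<dots> \<le> \<delta> ^ 3 * (8 * (\<delta> * E ^ 7)) / (8 * E ^ 7)"
    using E7 \<delta> E1 by (intro divide_right_mono mult_left_mono) auto
  also have "\<dots> = \<delta> ^ 4" using E1 by (simp add: eval_nat_numeral)
  finally show "16 * 2 powr d * \<alpha> * (sqrt (2 / 3) ^ T)\<^sup>2 \<le> \<delta> ^ 4" .
qed (use A \<alpha> \<delta> in auto)

text \<open>Of two complementary sets of buckets, one receives at least half of the inputs.\<close>

lemma exists_large_preimage:
  assumes h: "h ` {1..N} \<subseteq> {1..M}" and M: "2 \<le> M"
  obtains B where "B \<subseteq> {1..M}" "3 * card B \<le> 2 * M" "N \<le> 2 * card {x \<in> {1..N}. h x \<in> B}"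
proof -
  \<comment> \<open>The larger half has at most \<open>2 * M / 3\<close> buckets, with equality for
    \<open>M = 3\<close>; hence the constant \<open>sqrt (2 / 3)\<close>.\<close>
  define m where "m = (M + 1) div 2"
  define A where "A = (\<lambda>B. {x \<in> {1..N}. h x \<in> B})"
  have m: "m \<le> M" "3 * m \<le> 2 * M" "3 * (M - m) \<le> 2 * M" using M by (auto simp: m_def)
  have "{1..N} = A {1..m} \<union> A {m + 1..M}" using h m(1) by (fastforce simp: A_def)
  then have "card {1..N} \<le> card (A {1..m}) + card (A {m + 1..M})"
    using card_Un_le[of "A {1..m}" "A {m + 1..M}"] by presburger
  then have "N \<le> 2 * card (A {1..m}) \<or> N \<le> 2 * card (A {m + 1..M})"
    by (simp only: card_atLeastAtMost) linarith
  then show ?thesis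
    using that[of "{1..m}"] that[of "{m + 1..M}"] m by (auto simp: A_def)
qed

text \<open>After taking logarithms, with \<open>W\<close> the product of \<open>d\<close> and the
  maximum, the terms \<open>ln 16\<close>, \<open>d * ln 2\<close> and
  \<open>ln \<alpha> - 4 * ln \<delta>\<close> are at most \<open>4 * W\<close>, \<open>W\<close>
  and \<open>4 * W\<close>; here \<open>d \<ge> 1\<close> gives \<open>W \<ge> 1\<close>. Together
  they stay below \<open>10 * W \<le> 2 * G\<close>.\<close>

lemma far_half_subsets_numeric:
  fixes \<alpha> \<delta> d G :: real
  assumes \<delta>: "\<delta> > 0" "\<delta> < 1" and \<alpha>: "\<alpha> > 1" and d: "d \<ge> 1"
    and G: "5 * (d * max 1 (log 2 (\<alpha> / \<delta>))) \<le> G"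
  shows "16 * 2 powr d * \<alpha> * (exp (- G))\<^sup>2 \<le> \<delta> ^ 4"
proof -
  define m where "m = max 1 (log 2 (\<alpha> / \<delta>))"
  define W where "W = d * m"
  have m1: "m \<ge> 1" by (simp add: m_def)
  have "d * 1 \<le> W" "1 * m \<le> W" unfolding W_def using d m1 by (intro mult_mono; simp)+
  then have W: "d \<le> W" "m \<le> W" "1 \<le> W" using d by auto
  have ln2: "0 < ln (2::real)" "ln (2::real) \<le> 1" using ln_2_less_1 by auto
  have "ln \<alpha> - 4 * ln \<delta> \<le> 4 * (ln \<alpha> - ln \<delta>)" using \<alpha> by simp
  also have "ln \<alpha> - ln \<delta> = ln 2 * log 2 (\<alpha> / \<delta>)" using \<alpha> \<delta> by (simp add: log_def ln_div)
  also have "ln 2 * log 2 (\<alpha> / \<delta>) \<le> ln 2 * m" using ln2 by (intro mult_left_mono) (auto simp: m_def)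
  also have "ln 2 * m \<le> 1 * m" using ln2 m1 by (intro mult_right_mono) auto
  finally have 1: "ln \<alpha> - 4 * ln \<delta> \<le> 4 * W" using W by simp
  have "ln (16::real) = 4 * ln 2" using ln_realpow[of 2 4] by simp
  then have 2: "ln (16::real) \<le> 4 * W" using ln2 W by simp
  have 3: "d * ln 2 \<le> W" using mult_left_mono[OF ln2(2), of d] d W by linarith
  have "ln (16 * 2 powr d * \<alpha> * (exp (- G))\<^sup>2) = ln 16 + d * ln 2 + ln \<alpha> - 2 * G"
    using \<alpha> by (simp add: ln_mult ln_realpow ln_powr)
  also have "\<dots> \<le> 4 * ln \<delta>" using 1 2 3 W(3) G unfolding W_def[symmetric] m_def[symmetric] by linarith
  also have "\<dots> = ln (\<delta> ^ 4)" using \<delta> by (simp add: ln_realpow)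
  finally show ?thesis using \<alpha> \<delta> by (subst (asm) ln_le_cancel_iff) auto
qed

text \<open>The averaged bound on the coefficient leads to a list of half subsets with
  \<open>B = (1 - M / (100 * K)) ^ T \<le> exp (- M * T / (100 * K))\<close>, and \<open>G\<close>
  asks that this exponent be large enough.\<close>

lemma far_half_subsets:
  fixes \<alpha> \<delta> d :: real
  assumes fam: "hash_family N M \<H>" "\<H> \<noteq> {#}" "real (size \<H>) \<le> 2 powr d"
    and M: "2 \<le> M" "M \<le> 2 * K" and K: "K > 0" "2 * K \<le> N"
    and \<delta>: "\<delta> > 0" "\<delta> < 1" and \<alpha>: "\<alpha> > 1" and d: "d \<ge> 1"
    and G: "5 * (d * max 1 (log 2 (\<alpha> / \<delta>))) \<le> real M * real T / (100 * real K)"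
  shows "\<exists>As. length As = T \<and> (\<forall>A\<in>set As. A \<subseteq> {1..N} \<and> card A = K) \<and>
    (\<forall>Z. set_pmf Z \<subseteq> seqs M T \<longrightarrow> cp Z \<le> \<alpha> / real M ^ T \<longrightarrow>
       far (1 - \<delta>) (hashed \<H> (pmf_of_set (listset As))) Z) \<and>
    far (1 - \<delta>) (hashed \<H> (pmf_of_set (listset As))) (pmf_of_set (seqs M T))"
proof -
  define F where "F = {A. A \<subseteq> {1..2 * K} \<and> card A = K}"
  define \<gamma> where "\<gamma> = M / (100 * real K)"
  have "0 \<le> 1 - \<gamma>" using M K by (simp add: \<gamma>_def field_simps)
  have finF: "finite F" unfolding F_def by (rule finite_subset[of _ "Pow {1..2 * K}"]) auto
  have neF: "F \<noteq> {}" by (auto simp: F_def intro!: exI[of _ "{1..K}"])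
  have avg: "(\<Sum>A\<in>F. bhat M h A) \<le> (1 - \<gamma>) * card F" if h: "h \<in> set_mset \<H>" for h
  proof -
    have "h ` {1..N} \<subseteq> {1..M}" using fam(1) h by (auto simp: hash_family_def PiE_iff)
    then have "h ` {1..2 * K} \<subseteq> {1..M}" using K(2) by (fastforce simp: image_subset_iff)
    then show ?thesis unfolding F_def \<gamma>_def by (rule sum_bhat_half_subsets[OF K(1) M])
  qed
  obtain As where As: "length As = T" "set As \<subseteq> F"
    and le: "(\<Sum>h\<in>set_mset \<H>. pmf (pmf_of_multiset \<H>) h * (\<Prod>A\<leftarrow>As. bhat M h A)) \<le>
      (1 - \<gamma>) ^ T * (\<Sum>h\<in>set_mset \<H>. pmf (pmf_of_multiset \<H>) h)"
    using exists_list_sum_prod_le[where T = T and R = "set_mset \<H>" and g = "bhat M" and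
        w = "pmf (pmf_of_multiset \<H>)", OF finF neF \<open>0 \<le> 1 - \<gamma>\<close> pmf_nonneg bhat_nonneg avg]
    by blast
  have "(1 - \<gamma>) ^ T \<le> exp (- \<gamma>) ^ T"
    using exp_ge_add_one_self[of "- \<gamma>"] \<open>0 \<le> 1 - \<gamma>\<close> by (intro power_mono) auto
  also have "exp (- \<gamma>) ^ T = exp (- (real M * real T / (100 * real K)))"
    by (simp add: exp_of_nat_mult[symmetric] \<gamma>_def mult_ac)
  finally have B: "(\<Sum>h\<in>set_mset \<H>. pmf (pmf_of_multiset \<H>) h * (\<Prod>A\<leftarrow>As. bhat M h A)) \<le>
      exp (- (real M * real T / (100 * real K)))"
    using le by (simp add: sum_pmf_of_multiset[OF fam(2)])
  have sub: "A \<subseteq> {1..N} \<and> card A = K" if "A \<in> set As" for A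
    using that As(2) K(2) by (fastforce simp: F_def)
  have "A \<subseteq> {1..N} \<and> A \<noteq> {}" if "A \<in> set As" for A
    using sub[OF that] K(1) by auto
  then show ?thesis
    using far_listset[OF fam _ \<delta>(1) _ As(1) _ B far_half_subsets_numeric[OF \<delta> \<alpha> d G]] M(1) \<alpha> As(1) sub
    by (intro exI[of _ As]) auto
qed

theorem theorem4p9:
  "\<exists>c::real. c > 0 \<and>
     (\<forall>(N::nat) (M::nat) (T::nat) (d::real) (\<delta>::real) (\<alpha>::real) (\<H> :: (nat \<Rightarrow> nat) multiset).
        N > 0 \<longrightarrow> M \<ge> 2 \<longrightarrow> T > 0 \<longrightarrow> d > 0 \<longrightarrow>
        real N \<ge> real M * real T / d \<longrightarrow>
        0 < \<delta> \<longrightarrow> \<delta> < 1 \<longrightarrow> \<alpha> > 1 \<longrightarrow>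
        \<alpha> * 2 powr d < \<delta> ^ 3 * exp (real T / 32) / 128 \<longrightarrow>
        hash_family N M \<H> \<longrightarrow> \<H> \<noteq> {#} \<longrightarrow> real (size \<H>) \<le> 2 powr d \<longrightarrow>
        (\<exists>(K::int) (X :: nat list pmf).
           real_of_int K \<ge> c * (\<delta>\<^sup>2 * real M * real T / (d * max 1 (log 2 (\<alpha> / \<delta>)))) \<and>
           block_source N T (real_of_int K) X \<and>
           (\<forall>Z :: nat list pmf. set_pmf Z \<subseteq> seqs M T \<longrightarrow> cp Z \<le> \<alpha> / real M ^ T \<longrightarrow>
              far (1 - \<delta>) (hashed \<H> X) Z) \<and>
           far (1 - \<delta>) (hashed \<H> X) (pmf_of_set (seqs M T))))"
proof (rule exI[of _ "1 / 1000"], intro conjI allI impI)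
  fix N M T :: nat and d \<delta> \<alpha> :: real and \<H> :: "(nat \<Rightarrow> nat) multiset"
  assume N: "N > 0" and M: "M \<ge> 2" and T: "T > 0" and d: "d > 0"
    and NMT: "real N \<ge> real M * real T / d" and \<delta>: "0 < \<delta>" "\<delta> < 1" and \<alpha>: "\<alpha> > 1"
    and hyp: "\<alpha> * 2 powr d < \<delta> ^ 3 * exp (real T / 32) / 128"
    and fam: "hash_family N M \<H>" "\<H> \<noteq> {#}" "real (size \<H>) \<le> 2 powr d"
  define W where "W = d * max 1 (log 2 (\<alpha> / \<delta>))"
  \<comment> \<open>\<open>b\<close> is the bound required of \<open>K\<close>, up to the absolute
    constant. It is at most \<open>N\<close>, so sets of the required size fit into
    \<open>{1..N}\<close>.\<close>
  define b where "b = \<delta>\<^sup>2 * real M * real T / W"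
  have dW: "d \<le> W" using d by (simp add: W_def)
  have \<delta>2: "\<delta>\<^sup>2 \<le> 1" using \<delta> by (simp add: power_le_one)
  have bW: "b * W \<le> real M * real T"
    using d dW \<delta>2 mult_right_mono[of "\<delta>\<^sup>2" 1 "real M * real T"] by (simp add: b_def)
  have "b \<le> real M * real T / d"
    unfolding b_def using d dW \<delta>2 mult_right_mono[of "\<delta>\<^sup>2" 1 "real M * real T"]
    by (intro frac_le) auto
  then have bN: "b \<le> N" using NMT by linarith
  have h_img: "h ` {1..N} \<subseteq> {1..M}" if "h \<in># \<H>" for h
    using fam(1) that by (auto simp: hash_family_def PiE_iff)
  let ?P = "\<lambda>X. (\<forall>Z. set_pmf Z \<subseteq> seqs M T \<longrightarrow> cp Z \<le> \<alpha> / real M ^ T \<longrightarrow> far (1 - \<delta>) (hashed \<H> X) Z) \<and>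
    far (1 - \<delta>) (hashed \<H> X) (pmf_of_set (seqs M T))"
  have "\<exists>(K::nat) As. K > 0 \<and> 1 / 1000 * b \<le> real K \<and> length As = T \<and>
     (\<forall>A\<in>set As. A \<subseteq> {1..N} \<and> K \<le> card A) \<and> ?P (pmf_of_set (listset As))"
  proof (cases "d < 1")
    case True
    then have "2 powr d < 2 powr 1" by (intro powr_less_mono) auto
    then have "size \<H> < 2" using fam(3) by simp
    moreover have "size \<H> \<noteq> 0" using fam(2) by simp
    ultimately have "size \<H> = 1" by linarith
    then obtain h where h: "\<H> = {#h#}" using size_1_singleton_mset by blast
    then obtain B where B: "B \<subseteq> {1..M}" "3 * card B \<le> 2 * M" "N \<le> 2 * card {x \<in> {1..N}. h x \<in> B}"
      using exists_large_preimage[OF h_img M] by auto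
    define A where "A = {x \<in> {1..N}. h x \<in> B}"
    have cA: "card A > 0" using B(3) N unfolding A_def by linarith
    then have "A \<noteq> {}" by auto
    then have A: "A \<subseteq> {1..N}" "A \<noteq> {}" "finite A" by (auto simp: A_def)
    have "bhat M h A \<le> sqrt (real (card B) / real M)"
      by (rule bhat_le_sqrt_card) (use A B in \<open>auto simp: A_def\<close>)
    also have "\<dots> \<le> sqrt (2 / 3)" using B(2) M by (simp add: field_simps)
    finally have "?P (pmf_of_set (listset (replicate T A)))"
      by (intro far_replicate[OF fam _ \<delta> \<alpha> d hyp A(1,2)]) (use M h in auto)
    \<comment> \<open>The preimage has at least \<open>N / 2 \<ge> b / 2\<close> elements.\<close>
    moreover have "1 / 1000 * b \<le> card A" using B(3) bN unfolding A_def[symmetric] by linarith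
    ultimately show ?thesis using cA A
      by (intro exI[of _ "card A"] exI[of _ "replicate T A"]) auto
  next
    case False
    \<comment> \<open>The maximum keeps \<open>K\<close> positive when \<open>b\<close> is small. If
      \<open>K \<ge> 2\<close>, then \<open>b / 1000 > 1\<close>, so rounding up at most doubles it;
      this is the bound \<open>b / 500\<close>.\<close>
    define K where "K = max 1 (nat \<lceil>1 / 1000 * b\<rceil>)"
    have K: "K > 0" "1 / 1000 * b \<le> real K" unfolding K_def by linarith+
    have K2: "real K \<le> b / 500" if "K \<ge> 2"
      using that unfolding K_def by linarith
    have KN: "K \<le> N" using bN K2 N by (cases "K \<ge> 2") auto
    show ?thesis
    proof (cases "2 * K \<le> M")
      \<comment> \<open>The image of \<open>{1..K}\<close> under any \<open>h\<close> covers at most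
        half of the buckets.\<close>
      case True
      have "bhat M h {1..K} \<le> sqrt (2 / 3)" if h: "h \<in># \<H>" for h
      proof -
        have "bhat M h {1..K} \<le> sqrt (real (card (h ` {1..K})) / real M)"
          by (rule bhat_le_sqrt_card) (use K h_img[OF h] KN in \<open>auto simp: image_subset_iff\<close>)
        also have "\<dots> \<le> sqrt (2 / 3)"
          using card_image_le[of "{1..K}" h] True M by (simp add: field_simps)
        finally show ?thesis .
      qed
      then have "?P (pmf_of_set (listset (replicate T {1..K})))"
        by (intro far_replicate[OF fam _ \<delta> \<alpha> d hyp]) (use M K KN in auto)
      then show ?thesis using K KN
        by (intro exI[of _ K] exI[of _ "replicate T {1..K}"]) auto
    next
      case large: False
      \<comment> \<open>\<open>M \<ge> 2\<close> and \<open>2 * K > M\<close> exclude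
        \<open>K = 1\<close>. The constant 1000 is chosen so that
        \<open>500 * K * W \<le> b * W \<le> M * T\<close>, which is condition \<open>G\<close> of
        \<open>far_half_subsets\<close>.\<close>
      then have K2': "real K \<le> b / 500" using K2 M by linarith
      have "500 * real K * W \<le> b * W"
        using K2' d dW by (intro mult_right_mono) auto
      then have "5 * W \<le> real M * real T / (100 * real K)"
        using bW K(1) by (simp add: field_simps)
      moreover have "2 * K \<le> N" using K2' bN by linarith
      ultimately obtain As where "length As = T" "\<forall>A\<in>set As. A \<subseteq> {1..N} \<and> card A = K"
          "?P (pmf_of_set (listset As))"
        using far_half_subsets[OF fam M _ K(1) _ \<delta> \<alpha>, of T] False large unfolding W_def by auto
      then show ?thesis using K by (intro exI[of _ K] exI[of _ As]) auto
    qed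
  qed
  then obtain K As where K: "K > 0" "1 / 1000 * b \<le> real K" "length As = T"
    and As: "\<And>A. A \<in> set As \<Longrightarrow> A \<subseteq> {1..N} \<and> K \<le> card A" and P: "?P (pmf_of_set (listset As))"
    by blast
  have "block_source N T (real_of_int (int K)) (pmf_of_set (listset As))"
    using block_source_listset[of As N K] As K by simp
  then show "\<exists>(K::int) X.
     real_of_int K \<ge> 1 / 1000 * (\<delta>\<^sup>2 * real M * real T / (d * max 1 (log 2 (\<alpha> / \<delta>)))) \<and>
     block_source N T (real_of_int K) X \<and> ?P X"
    using K(2) P unfolding b_def W_def
    by (intro exI[of _ "int K"] exI[of _ "pmf_of_set (listset As)"]) simp
qed simp

end
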